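(* For every normalized binary goods instance with laminar approval sets, with an arbitrary number of agents, an allocation that is both EF1 and EQ1 exists, and such an allocation can be computed in polynomial time.
   Context: An instance consists of agents $N=\{1,\dots,n\}$, a finite set $M$ of indivisible items, and for each agent $i$ an additive valuation $v_i:2^M\to\mathbb{R}$, i.e. $v_i(\emptyset)=0$ and $v_i(S)=\sum_{o\in S}v_i(o)$. It is a binary goods instance if $v_i(o)\in\{0,1\}$ for all $i,o$. It is normalized if $v_i(M)=v_j(M)$ for all $i,j\in N$. The approval set of agent $i$ is $\Gamma_i=\{g\in M: v_i(g)=1\}$; the approval sets are laminar if any two of them are disjoint or one contains the other. An allocation $A=(A_1,\dots,A_n)$ is a partition of $M$ into $n$ pairwise disjoint, possibly empty bundles with union $M$. For goods: $A$ is EF1 if for all $i,j\in N$ with $A_j\neq\emptyset$ there is $g\in A_j$ with $v_i(A_i)\ge v_i(A_j\setminus\{g\})$. $A$ is EQ1 if for all $i,j\in N$ with $A_j\neq\emptyset$ there is $g\in A_j$ with $v_i(A_i)\ge v_j(A_j\setminus\{g\})$. *)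

theory Defs
  imports Complex_Main "HOL-Library.Disjoint_Sets" "HOL-Computational_Algebra.Polynomial"
begin

text \<open>The agents are \<open>{1..n}\<close>. The value of a single item \<open>g\<close> to agent \<open>i\<close> is \<open>v i {g}\<close>; only the
  values of subsets of \<open>M\<close> are constrained. At least one agent is required, since otherwise a
  nonempty \<open>M\<close> has no allocation at all.\<close>

definition fair_division_instance :: "nat \<Rightarrow> 'a set \<Rightarrow> (nat \<Rightarrow> 'a set \<Rightarrow> real) \<Rightarrow> bool" where
  "fair_division_instance n M v \<longleftrightarrow> n \<ge> 1 \<and> finite M \<and>
     (\<forall>i\<in>{1..n}. v i {} = 0 \<and> (\<forall>S\<subseteq>M. v i S = (\<Sum>g\<in>S. v i {g})))"

definition binary_goods :: "nat \<Rightarrow> 'a set \<Rightarrow> (nat \<Rightarrow> 'a set \<Rightarrow> real) \<Rightarrow> bool" where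
  "binary_goods n M v \<longleftrightarrow> (\<forall>i\<in>{1..n}. \<forall>g\<in>M. v i {g} \<in> {0, 1})"

definition normalized :: "nat \<Rightarrow> 'a set \<Rightarrow> (nat \<Rightarrow> 'a set \<Rightarrow> real) \<Rightarrow> bool" where
  "normalized n M v \<longleftrightarrow> (\<forall>i\<in>{1..n}. \<forall>j\<in>{1..n}. v i M = v j M)"

definition approval_set :: "'a set \<Rightarrow> (nat \<Rightarrow> 'a set \<Rightarrow> real) \<Rightarrow> nat \<Rightarrow> 'a set" where
  "approval_set M v i = {g \<in> M. v i {g} = 1}"

definition laminar_approvals :: "nat \<Rightarrow> 'a set \<Rightarrow> (nat \<Rightarrow> 'a set \<Rightarrow> real) \<Rightarrow> bool" where
  "laminar_approvals n M v \<longleftrightarrow> (\<forall>i\<in>{1..n}. \<forall>j\<in>{1..n}.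
     approval_set M v i \<inter> approval_set M v j = {} \<or>
     approval_set M v i \<subseteq> approval_set M v j \<or>
     approval_set M v j \<subseteq> approval_set M v i)"

definition allocation :: "nat \<Rightarrow> 'a set \<Rightarrow> (nat \<Rightarrow> 'a set) \<Rightarrow> bool" where
  "allocation n M A \<longleftrightarrow> disjoint_family_on A {1..n} \<and> (\<Union>i\<in>{1..n}. A i) = M"

definition EF1 :: "nat \<Rightarrow> (nat \<Rightarrow> 'a set \<Rightarrow> real) \<Rightarrow> (nat \<Rightarrow> 'a set) \<Rightarrow> bool" where
  "EF1 n v A \<longleftrightarrow> (\<forall>i\<in>{1..n}. \<forall>j\<in>{1..n}. A j \<noteq> {} \<longrightarrow>
     (\<exists>g\<in>A j. v i (A i) \<ge> v i (A j - {g})))"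

definition EQ1 :: "nat \<Rightarrow> (nat \<Rightarrow> 'a set \<Rightarrow> real) \<Rightarrow> (nat \<Rightarrow> 'a set) \<Rightarrow> bool" where
  "EQ1 n v A \<longleftrightarrow> (\<forall>i\<in>{1..n}. \<forall>j\<in>{1..n}. A j \<noteq> {} \<longrightarrow>
     (\<exists>g\<in>A j. v i (A i) \<ge> v j (A j - {g})))"

text \<open>A structured random-access machine: scalar registers and arrays, both holding natural numbers,
  with constants, addition, truncated subtraction and indirect access. Every operation has unit
  cost, and cost is charged for each node of an expression. There is deliberately no
  multiplication: since one operation lengthens the largest stored number by at most one bit,
  polynomial time on this machine coincides with polynomial time on Turing machines.\<close>

datatype expr =
    Const nat
  | Reg nat
  | Cell nat expr  \<comment> \<open>\<open>Cell a e\<close> reads array \<open>a\<close> at index \<open>e\<close>\<close>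
  | Add expr expr
  | Sub expr expr

datatype prog =
    Skip
  | Assign nat expr
  | Store nat expr expr  \<comment> \<open>\<open>Store a e1 e2\<close> writes \<open>e2\<close> to array \<open>a\<close> at index \<open>e1\<close>\<close>
  | Seq prog prog
  | IfNZ expr prog prog
  | WhileNZ expr prog

record memory =
  regs :: "nat \<Rightarrow> nat"
  arrays :: "nat \<Rightarrow> nat \<Rightarrow> nat"

primrec eval_expr :: "expr \<Rightarrow> memory \<Rightarrow> nat" where
  "eval_expr (Const c) s = c"
| "eval_expr (Reg x) s = regs s x"
| "eval_expr (Cell a e) s = arrays s a (eval_expr e s)"
| "eval_expr (Add e1 e2) s = eval_expr e1 s + eval_expr e2 s"
| "eval_expr (Sub e1 e2) s = eval_expr e1 s - eval_expr e2 s"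

primrec expr_cost :: "expr \<Rightarrow> nat" where
  "expr_cost (Const c) = 1"
| "expr_cost (Reg x) = 1"
| "expr_cost (Cell a e) = 1 + expr_cost e"
| "expr_cost (Add e1 e2) = 1 + expr_cost e1 + expr_cost e2"
| "expr_cost (Sub e1 e2) = 1 + expr_cost e1 + expr_cost e2"

text \<open>\<open>runs P s t s'\<close>: started in \<open>s\<close>, the program \<open>P\<close> halts in \<open>s'\<close> after exactly \<open>t\<close> steps.\<close>

inductive runs :: "prog \<Rightarrow> memory \<Rightarrow> nat \<Rightarrow> memory \<Rightarrow> bool" where
  Skip: "runs Skip s 1 s"
| Assign: "runs (Assign x e) s (1 + expr_cost e) (s\<lparr>regs := (regs s)(x := eval_expr e s)\<rparr>)"
| Store: "runs (Store a e1 e2) s (1 + expr_cost e1 + expr_cost e2)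
    (s\<lparr>arrays := (arrays s)(a := (arrays s a)(eval_expr e1 s := eval_expr e2 s))\<rparr>)"
| Seq: "runs P s t s' \<Longrightarrow> runs Q s' u s'' \<Longrightarrow> runs (Seq P Q) s (t + u) s''"
| IfTrue: "eval_expr e s \<noteq> 0 \<Longrightarrow> runs P s t s' \<Longrightarrow> runs (IfNZ e P Q) s (1 + expr_cost e + t) s'"
| IfFalse: "eval_expr e s = 0 \<Longrightarrow> runs Q s t s' \<Longrightarrow> runs (IfNZ e P Q) s (1 + expr_cost e + t) s'"
| WhileFalse: "eval_expr e s = 0 \<Longrightarrow> runs (WhileNZ e P) s (1 + expr_cost e) s"
| WhileTrue: "eval_expr e s \<noteq> 0 \<Longrightarrow> runs P s t s' \<Longrightarrow> runs (WhileNZ e P) s' u s'' \<Longrightarrow>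
    runs (WhileNZ e P) s (1 + expr_cost e + t + u) s''"

text \<open>A binary instance with \<open>n\<close> agents and items \<open>{..<m}\<close> is presented to the machine by \<open>n\<close> and \<open>m\<close> in
  registers 0 and 1 and the 0/1 valuation matrix, stored row by row (one row per agent), in
  array 0. Everything else is initially 0.\<close>

definition input_memory :: "nat \<Rightarrow> nat \<Rightarrow> (nat \<Rightarrow> nat set \<Rightarrow> real) \<Rightarrow> memory" where
  "input_memory n m v = \<lparr>
     regs = (\<lambda>_. 0)(0 := n, 1 := m),
     arrays = (\<lambda>_ _. 0)(0 := (\<lambda>c. if c < n * m \<and> v (c div m + 1) {c mod m} = 1 then 1 else 0))\<rparr>"

text \<open>The result is read off array 1, whose cell \<open>g\<close> holds the agent receiving item \<open>g\<close>.\<close>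

definition output_bundles :: "nat \<Rightarrow> memory \<Rightarrow> nat \<Rightarrow> nat set" where
  "output_bundles m s i = {g \<in> {..<m}. arrays s 1 g = i}"

end

theory Submission
  imports Defs
begin

text \<open>Normalization makes all approval sets have the same size \<open>k\<close>, so two laminar ones are equal
  or disjoint. Let the agents pick approved items round by round until, in round \<open>r\<close>, some agent finds
  none left. Then every agent has value at least \<open>r - 1\<close>, no bundle has more than \<open>r\<close> items, and
  \<open>k \<le> n * r\<close> because the approval set of the stuck agent is exhausted. Give each remaining item of an
  approval set \<open>\<Gamma>\<close> to any agent holding fewer than \<open>r\<close> items of \<open>\<Gamma>\<close>; one exists as \<open>k \<le> n * r\<close>. In the
  end every agent has value at least \<open>r - 1\<close> and no bundle is worth more than \<open>r\<close> to anybody,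
  which gives both EF1 and EQ1.\<close>

section \<open>Timed weakest preconditions\<close>

text \<open>Total correctness within a time budget. The memory comes last so that
  \<open>achieves P' T' Q\<close> can itself serve as a postcondition, which turns sequencing into
  nesting.\<close>

definition achieves :: "prog \<Rightarrow> nat \<Rightarrow> (memory \<Rightarrow> bool) \<Rightarrow> memory \<Rightarrow> bool" where
  "achieves P T Q s \<longleftrightarrow> (\<exists>t s'. runs P s t s' \<and> t \<le> T \<and> Q s')"

text \<open>Truncated subtraction makes the guard test whether register \<open>x\<close> is below
  \<open>e\<close>, which is evaluated afresh at every pass.\<close>

definition For :: "nat \<Rightarrow> expr \<Rightarrow> prog \<Rightarrow> prog" where
  "For x e P = Seq (Assign x (Const 0))
     (WhileNZ (Sub e (Reg x)) (Seq P (Assign x (Add (Reg x) (Const 1)))))"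

abbreviation set_reg :: "nat \<Rightarrow> nat \<Rightarrow> memory \<Rightarrow> memory" where
  "set_reg x a s \<equiv> s\<lparr>regs := (regs s)(x := a)\<rparr>"

abbreviation set_cell :: "nat \<Rightarrow> nat \<Rightarrow> nat \<Rightarrow> memory \<Rightarrow> memory" where
  "set_cell a c b s \<equiv> s\<lparr>arrays := (arrays s)(a := (arrays s a)(c := b))\<rparr>"

lemma achieves_mono:
  "achieves P T Q s \<Longrightarrow> T \<le> T' \<Longrightarrow> (\<And>s'. Q s' \<Longrightarrow> Q' s') \<Longrightarrow> achieves P T' Q' s"
  unfolding achieves_def by (meson le_trans)

lemma achieves_Skip: "Q s \<Longrightarrow> 1 \<le> T \<Longrightarrow> achieves Skip T Q s"
  unfolding achieves_def using runs.Skip by blast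

lemma achieves_Assign:
  "Q (set_reg x (eval_expr e s) s) \<Longrightarrow> 1 + expr_cost e \<le> T \<Longrightarrow> achieves (Assign x e) T Q s"
  unfolding achieves_def using runs.Assign by blast

lemma achieves_Store:
  "Q (set_cell a (eval_expr e1 s) (eval_expr e2 s) s) \<Longrightarrow> 1 + expr_cost e1 + expr_cost e2 \<le> T \<Longrightarrow>
    achieves (Store a e1 e2) T Q s"
  unfolding achieves_def using runs.Store by blast

lemma achieves_Seq:
  assumes "achieves P T (achieves P' T' Q) s" "T + T' \<le> U"
  shows "achieves (Seq P P') U Q s"
proof -
  obtain t s' t' s'' where "runs P s t s'" "t \<le> T" "runs P' s' t' s''" "t' \<le> T'" "Q s''"
    using assms(1) unfolding achieves_def by blast
  then show ?thesis
    using assms(2) runs.Seq unfolding achieves_def by (meson add_mono le_trans)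
qed

lemma achieves_IfNZ:
  assumes "eval_expr e s \<noteq> 0 \<Longrightarrow> achieves P T Q s" "eval_expr e s = 0 \<Longrightarrow> achieves P' T Q s"
    and "1 + expr_cost e + T \<le> U"
  shows "achieves (IfNZ e P P') U Q s"
proof (cases "eval_expr e s = 0")
  case True
  then obtain t s' where "runs P' s t s'" "t \<le> T" "Q s'"
    using assms(2) unfolding achieves_def by blast
  with True have "runs (IfNZ e P P') s (1 + expr_cost e + t) s'" "1 + expr_cost e + t \<le> U"
    using assms(3) by (blast intro: runs.IfFalse, linarith)
  with \<open>Q s'\<close> show ?thesis unfolding achieves_def by blast
next
  case False
  then obtain t s' where "runs P s t s'" "t \<le> T" "Q s'"
    using assms(1) unfolding achieves_def by blast
  with False have "runs (IfNZ e P P') s (1 + expr_cost e + t) s'" "1 + expr_cost e + t \<le> U"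
    using assms(3) by (blast intro: runs.IfTrue, linarith)
  with \<open>Q s'\<close> show ?thesis unfolding achieves_def by blast
qed

text \<open>\<open>I k\<close> describes the memory once the counter is \<open>k\<close>, so the
  body answers for the memory after the increment. A pass costs \<open>T\<close>, plus 4 for the
  increment and \<open>3 + expr_cost e\<close> for the guard; initialization costs 2 and the last
  guard test \<open>3 + expr_cost e\<close>.\<close>

lemma achieves_For:
  assumes init: "I 0 (set_reg x 0 s)"
    and bound: "\<And>k s. I k s \<Longrightarrow> eval_expr e s = N"
    and body: "\<And>k s. k < N \<Longrightarrow> I k s \<Longrightarrow> regs s x = k \<Longrightarrow>
      achieves P T (\<lambda>s'. regs s' x = k \<and> I (Suc k) (set_reg x (Suc k) s')) s"
    and final: "\<And>s. I N s \<Longrightarrow> Q s"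
    and time: "5 + expr_cost e + N * (T + 7 + expr_cost e) \<le> U"
  shows "achieves (For x e P) U Q s"
proof -
  let ?W = "WhileNZ (Sub e (Reg x)) (Seq P (Assign x (Add (Reg x) (Const 1))))"
  have loop: "achieves ?W (3 + expr_cost e + (N - k) * (T + 7 + expr_cost e)) Q s"
    if "k \<le> N" "I k s" "regs s x = k" for k s
    using that
  proof (induction "N - k" arbitrary: k s)
    case 0
    then have "k = N" by simp
    then have "runs ?W s (1 + expr_cost (Sub e (Reg x))) s"
      using 0 bound[of k s] by (intro runs.WhileFalse) auto
    moreover have "Q s"
      using 0 \<open>k = N\<close> final by blast
    ultimately show ?case
      unfolding achieves_def by force
  next
    case (Suc d)
    then have "k < N" by simp
    then obtain t s' where P: "runs P s t s'" "t \<le> T" "regs s' x = k"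
        "I (Suc k) (set_reg x (Suc k) s')"
      using body[of k s] Suc.prems unfolding achieves_def by blast
    have "achieves ?W (3 + expr_cost e + (N - Suc k) * (T + 7 + expr_cost e)) Q
        (set_reg x (Suc k) s')"
      using Suc \<open>k < N\<close> P by (intro Suc.hyps(1)) auto
    then obtain u s'' where W: "runs ?W (set_reg x (Suc k) s') u s''" "Q s''"
        "u \<le> 3 + expr_cost e + (N - Suc k) * (T + 7 + expr_cost e)"
      unfolding achieves_def by blast
    have "runs (Seq P (Assign x (Add (Reg x) (Const 1)))) s (t + 4) (set_reg x (Suc k) s')"
      using runs.Seq[OF P(1) runs.Assign[of x "Add (Reg x) (Const 1)" s']] P(3)
      by (simp add: numeral_eq_Suc)
    from runs.WhileTrue[OF _ this W(1)]
    have "runs ?W s (1 + expr_cost (Sub e (Reg x)) + (t + 4) + u) s''"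
      using Suc.prems bound[of k s] \<open>k < N\<close> by simp
    moreover have "N - k = Suc (N - Suc k)" using \<open>k < N\<close> by simp
    then have "1 + expr_cost (Sub e (Reg x)) + (t + 4) + u
        \<le> 3 + expr_cost e + (N - k) * (T + 7 + expr_cost e)"
      using W(3) P(2) by simp
    ultimately show ?case
      using W(2) unfolding achieves_def by blast
  qed
  show ?thesis
    unfolding For_def
    by (rule achieves_Seq[where T = 2], rule achieves_Assign)
       (use loop[of 0 "set_reg x 0 s"] init time in \<open>auto intro: achieves_mono\<close>)
qed

section \<open>The program\<close>

text \<open>Register 2 holds the number of rounds, which becomes the cap, and register 3 is nonzero
  once an agent has been unable to pick an item. Cell \<open>i\<close> of array 2 holds the offset \<open>i * m\<close> of row \<open>i\<close>.\<close>

definition entry :: "nat \<Rightarrow> nat \<Rightarrow> expr" where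
  "entry x y = Cell 0 (Add (Cell 2 (Reg x)) (Reg y))"

text \<open>In the absence of multiplication, the multiples of \<open>m\<close> are accumulated in
  register 5, which is initially 0.\<close>

definition offsets :: prog where
  "offsets = For 4 (Reg 0) (Seq (Store 2 (Reg 4) (Reg 5)) (Assign 5 (Add (Reg 5) (Reg 1))))"

text \<open>Register 7 codes the search result: 0 for none, \<open>Suc g\<close> for item
  \<open>g\<close>. Matrix entries are 0 or 1, so the truncated difference is nonzero exactly for an
  approved unassigned item.\<close>

definition pick :: prog where
  "pick = Seq (Assign 7 (Const 0)) (Seq
     (For 6 (Reg 1) (IfNZ (Sub (entry 5 6) (Cell 1 (Reg 6))) (Assign 7 (Add (Reg 6) (Const 1))) Skip))
     (IfNZ (Reg 7) (Store 1 (Sub (Reg 7) (Const 1)) (Add (Reg 5) (Const 1))) (Assign 3 (Const 1))))"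

text \<open>A failing round is played to its end and still counted in register 2; later passes are
  idle. At most \<open>m\<close> rounds can succeed, so \<open>m + 1\<close> passes include a
  failing one.\<close>

definition rounds :: prog where
  "rounds = For 4 (Add (Reg 1) (Const 1))
     (IfNZ (Reg 3) Skip (Seq (For 5 (Reg 0) pick) (Assign 2 (Add (Reg 2) (Const 1)))))"

text \<open>Agent 0 is the default when nobody approves the item. Any approver will do, since
  approval sets that share an item coincide.\<close>

definition find_approver :: prog where
  "find_approver = Seq (Assign 7 (Const 0))
     (For 5 (Reg 0) (IfNZ (entry 5 4) (Assign 7 (Reg 5)) Skip))"

text \<open>The two truncated differences add up to a distance, which is zero exactly for items
  owned by the agent in register 5.\<close>

definition count_held :: prog where
  "count_held = Seq (Assign 9 (Const 0)) (For 6 (Reg 1)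
     (IfNZ (Add (Sub (Cell 1 (Reg 6)) (Add (Reg 5) (Const 1)))
                (Sub (Add (Reg 5) (Const 1)) (Cell 1 (Reg 6))))
        Skip (Assign 9 (Add (Reg 9) (entry 7 6)))))"

definition find_taker :: prog where
  "find_taker = Seq (Assign 8 (Const 0)) (For 5 (Reg 0)
     (Seq count_held (IfNZ (Sub (Reg 2) (Reg 9)) (Assign 8 (Reg 5)) Skip)))"

definition completion :: prog where
  "completion = For 4 (Reg 1) (IfNZ (Cell 1 (Reg 4)) Skip
     (Seq find_approver (Seq find_taker (Store 1 (Reg 4) (Add (Reg 8) (Const 1))))))"

definition allocate :: prog where
  "allocate = Seq offsets (Seq rounds completion)"

section \<open>Round robin with completion\<close>

text \<open>The combinatorial content of normalization and laminarity. Agents are numbered from 0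
  here.\<close>

locale disjoint_approvals =
  fixes n m k :: nat and \<Gamma> :: "nat \<Rightarrow> nat set"
  assumes n_pos: "n \<ge> 1"
    and \<Gamma>_subset: "i < n \<Longrightarrow> \<Gamma> i \<subseteq> {..<m}"
    and card_\<Gamma>: "i < n \<Longrightarrow> card (\<Gamma> i) = k"
    and \<Gamma>_eq: "i < n \<Longrightarrow> j < n \<Longrightarrow> g \<in> \<Gamma> i \<Longrightarrow> g \<in> \<Gamma> j \<Longrightarrow> \<Gamma> i = \<Gamma> j"
begin

text \<open>Partial allocations are functions \<open>out\<close> with \<open>out g = 0\<close> if item \<open>g\<close> is unassigned and
  \<open>out g = Suc j\<close> if it belongs to agent \<open>j < n\<close>.\<close>

definition held :: "(nat \<Rightarrow> nat) \<Rightarrow> nat \<Rightarrow> nat \<Rightarrow> nat" where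
  "held out j i = card {g \<in> \<Gamma> i. out g = Suc j}"

definition load :: "(nat \<Rightarrow> nat) \<Rightarrow> nat \<Rightarrow> nat" where
  "load out j = card {g \<in> {..<m}. out g = Suc j}"

text \<open>\<open>r\<close> rounds are complete, agent \<open>i\<close> is next, and
  \<open>stop\<close> is the flag in register 3. After a failure only the \<open>r\<close> items
  from complete rounds are guaranteed to each agent, and the exhausted approval set is
  recorded.\<close>

definition in_round :: "(nat \<Rightarrow> nat) \<Rightarrow> nat \<Rightarrow> nat \<Rightarrow> nat \<Rightarrow> bool" where
  "in_round out r i stop \<longleftrightarrow> (\<forall>g. out g \<le> n) \<and>
     (\<forall>j<n. load out j \<le> r + of_bool (j < i)) \<and>
     (\<forall>j<n. r + of_bool (j < i \<and> stop = 0) \<le> held out j j) \<and>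
     (stop \<noteq> 0 \<longrightarrow> (\<exists>j<n. \<forall>g\<in>\<Gamma> j. out g \<noteq> 0))"

text \<open>Invariant of the completion phase: \<open>k \<le> n * r\<close> keeps room for the items
  still to be given, and \<open>Suc\<close> avoids the subtraction in \<open>r - 1\<close>.\<close>

definition capped :: "(nat \<Rightarrow> nat) \<Rightarrow> nat \<Rightarrow> bool" where
  "capped out r \<longleftrightarrow> (\<forall>g. out g \<le> n) \<and> k \<le> n * r \<and>
     (\<forall>i<n. \<forall>j<n. held out j i \<le> r) \<and> (\<forall>j<n. r \<le> Suc (held out j j))"

section \<open>Counting and preservation of the invariants\<close>

lemma finite_\<Gamma>: "i < n \<Longrightarrow> finite (\<Gamma> i)"
  using \<Gamma>_subset finite_subset by blast

lemma held_le_load: "i < n \<Longrightarrow> held out j i \<le> load out j"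
  unfolding held_def load_def using \<Gamma>_subset[of i] by (intro card_mono) auto

lemma held_update:
  assumes "i < n" "out g = 0"
  shows "held (out(g := Suc l)) j i = held out j i + of_bool (j = l \<and> g \<in> \<Gamma> i)"
proof -
  have "{h \<in> \<Gamma> i. (out(g := Suc l)) h = Suc j} =
      (if j = l \<and> g \<in> \<Gamma> i then insert g {h \<in> \<Gamma> i. out h = Suc j} else {h \<in> \<Gamma> i. out h = Suc j})"
    using assms(2) by auto
  then show ?thesis
    using assms finite_\<Gamma>[of i] by (simp add: held_def)
qed

lemma load_update:
  assumes "g < m" "out g = 0"
  shows "load (out(g := Suc l)) j = load out j + of_bool (j = l)"
proof -
  have "{h \<in> {..<m}. (out(g := Suc l)) h = Suc j} =
      (if j = l then insert g {h \<in> {..<m}. out h = Suc j} else {h \<in> {..<m}. out h = Suc j})"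
    using assms by auto
  then show ?thesis
    using assms by (simp add: load_def)
qed

text \<open>Double counting: the assigned items of \<open>\<Gamma> i\<close> are grouped by owner,
  and \<open>out g \<le> n\<close> ensures that every owner is an agent.\<close>

lemma sum_held:
  assumes "i < n" "\<forall>g. out g \<le> n"
  shows "(\<Sum>j<n. held out j i) = card {g \<in> \<Gamma> i. out g \<noteq> 0}"
proof -
  have "{g \<in> \<Gamma> i. out g \<noteq> 0} = (\<Union>j<n. {g \<in> \<Gamma> i. out g = Suc j})"
  proof (intro equalityI subsetI)
    fix g assume "g \<in> {g \<in> \<Gamma> i. out g \<noteq> 0}"
    then obtain j where "g \<in> \<Gamma> i" "out g = Suc j"
      using not0_implies_Suc by blast
    moreover from this have "j < n" using assms(2) Suc_le_eq by metis
    ultimately show "g \<in> (\<Union>j<n. {g \<in> \<Gamma> i. out g = Suc j})" by blast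
  qed auto
  moreover have "card (\<Union>j<n. {g \<in> \<Gamma> i. out g = Suc j}) = (\<Sum>j<n. held out j i)"
    unfolding held_def using finite_\<Gamma>[OF assms(1)] by (intro card_UN_disjoint) auto
  ultimately show ?thesis by simp
qed

lemma in_round_give:
  assumes "in_round out r i stop" "i < n" "g \<in> \<Gamma> i" "out g = 0"
  shows "in_round (out(g := Suc i)) r (Suc i) stop"
proof -
  have "g < m" using assms \<Gamma>_subset by blast
  show ?thesis
    using assms unfolding in_round_def
    by (auto simp: held_update load_update[OF \<open>g < m\<close>] less_Suc_eq)
qed

lemma in_round_stop:
  assumes "in_round out r i stop" "i < n" "\<forall>g\<in>\<Gamma> i. out g \<noteq> 0"
  shows "in_round out r (Suc i) 1"
  using assms unfolding in_round_def
  by (auto simp: less_Suc_eq)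

lemma in_round_next: "in_round out r n 0 \<Longrightarrow> in_round out (Suc r) 0 0"
  unfolding in_round_def by auto

text \<open>Agent 0 holds at least \<open>r\<close> items it approves, and there are only
  \<open>m\<close> items. This bounds the number of successful rounds.\<close>

lemma in_round_le:
  assumes "in_round out r 0 0"
  shows "r \<le> m"
proof -
  have "r \<le> held out 0 0" using assms n_pos unfolding in_round_def by auto
  also have "\<dots> \<le> card (\<Gamma> 0)"
    unfolding held_def using finite_\<Gamma>[of 0] n_pos by (intro card_mono) auto
  also have "\<dots> \<le> card {..<m}"
    using \<Gamma>_subset[of 0] n_pos by (intro card_mono) auto
  finally show ?thesis by simp
qed

text \<open>The failing round may add one more item to a bundle, hence the cap \<open>Suc r\<close>.
  All \<open>k\<close> items of the stuck agent's set are assigned, at most \<open>Suc r\<close> of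
  them to each of the \<open>n\<close> agents.\<close>

lemma in_round_capped:
  assumes "in_round out r n stop" "stop \<noteq> 0"
  shows "capped out (Suc r)"
proof -
  obtain j where j: "j < n" "\<forall>g\<in>\<Gamma> j. out g \<noteq> 0" and out: "\<forall>g. out g \<le> n"
    and load: "\<And>l. l < n \<Longrightarrow> load out l \<le> Suc r"
    and own: "\<And>l. l < n \<Longrightarrow> r \<le> held out l l"
    using assms unfolding in_round_def by auto
  have held: "held out l i \<le> Suc r" if "l < n" "i < n" for l i
    using load[OF that(1)] held_le_load[OF that(2)] le_trans by blast
  have "{g \<in> \<Gamma> j. out g \<noteq> 0} = \<Gamma> j" using j by auto
  then have "k = (\<Sum>l<n. held out l j)"
    using card_\<Gamma>[OF j(1)] sum_held[OF j(1) out] by simp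
  also have "\<dots> \<le> n * Suc r"
    using sum_bounded_above[of "{..<n}" "\<lambda>l. held out l j" "Suc r"] held j(1) by simp
  finally show ?thesis
    unfolding capped_def using out own held by auto
qed

text \<open>Pigeonhole: if every agent held \<open>r\<close> items of \<open>\<Gamma> i\<close>, at
  least \<open>n * r \<ge> k\<close> of them would be assigned, yet \<open>g\<close> is not.\<close>

lemma capped_taker:
  assumes "capped out r" "i < n" "g \<in> \<Gamma> i" "out g = 0"
  shows "\<exists>j<n. held out j i < r"
proof (rule ccontr)
  assume "\<not> ?thesis"
  then have "(\<Sum>j<n. r) \<le> (\<Sum>j<n. held out j i)"
    by (intro sum_mono) (meson lessThan_iff not_less)
  then have "n * r \<le> (\<Sum>j<n. held out j i)" by simp
  also have "\<dots> = card {h \<in> \<Gamma> i. out h \<noteq> 0}"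
    using sum_held assms unfolding capped_def by blast
  also have "\<dots> < card (\<Gamma> i)"
    using assms finite_\<Gamma>[OF assms(2)] by (intro psubset_card_mono) blast+
  also have "\<dots> \<le> n * r"
    using assms card_\<Gamma> unfolding capped_def by simp
  finally show False by simp
qed

text \<open>Own counts only grow, so only the caps of agents approving \<open>g\<close> are at
  stake; an item nobody approves may go to anyone.\<close>

lemma capped_give:
  assumes "capped out r" "out g = 0" "j < n"
    and "\<And>i. i < n \<Longrightarrow> g \<in> \<Gamma> i \<Longrightarrow> held out j i < r"
  shows "capped (out(g := Suc j)) r"
  using assms unfolding capped_def
  by (auto simp: held_update Suc_le_eq le_SucI)

section \<open>Representation of partial allocations in memory\<close>

definition rows :: "(nat \<Rightarrow> nat) \<Rightarrow> bool" where
  "rows f \<longleftrightarrow> (\<forall>i<n. \<forall>g<m. f (i * m + g) = of_bool (g \<in> \<Gamma> i))"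

text \<open>Registers from 3 upward are left free, so writes to them preserve this relation by
  simplification.\<close>

definition stores :: "(nat \<Rightarrow> nat) \<Rightarrow> nat \<Rightarrow> memory \<Rightarrow> bool" where
  "stores out r s \<longleftrightarrow> regs s 0 = n \<and> regs s 1 = m \<and> regs s 2 = r \<and> arrays s 1 = out \<and>
     (\<forall>i<n. arrays s 2 i = i * m) \<and>
     rows (arrays s 0)"

lemma stores_regs [simp]:
  "f 0 = regs s 0 \<Longrightarrow> f 1 = regs s 1 \<Longrightarrow> f 2 = regs s 2 \<Longrightarrow>
    stores out r (s\<lparr>regs := f\<rparr>) \<longleftrightarrow> stores out r s"
  by (simp add: stores_def)

lemma stores_cap:
  "stores out r s \<Longrightarrow> f 0 = regs s 0 \<Longrightarrow> f 1 = regs s 1 \<Longrightarrow> f 2 = r' \<Longrightarrow>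
    stores out r' (s\<lparr>regs := f\<rparr>)"
  by (simp add: stores_def)

lemma stores_set_cell: "stores out r s \<Longrightarrow> stores (out(g := a)) r (set_cell 1 g a s)"
  by (simp add: stores_def)

lemma storesD [simp]:
  assumes "stores out r s"
  shows "regs s 0 = n" "regs s (Suc 0) = m" "regs s 2 = r" "arrays s (Suc 0) = out"
  using assms by (auto simp: stores_def)

lemma eval_entry [simp]:
  assumes "stores out r s" "regs s x < n" "regs s y < m"
  shows "eval_expr (entry x y) s = of_bool (regs s y \<in> \<Gamma> (regs s x))"
proof -
  have "arrays s 2 (regs s x) = regs s x * m"
    "arrays s 0 (regs s x * m + regs s y) = of_bool (regs s y \<in> \<Gamma> (regs s x))"
    using assms unfolding stores_def rows_def by blast+
  then show ?thesis by (simp add: entry_def)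
qed

lemma expr_cost_entry [simp]: "expr_cost (entry x y) = 5"
  by (simp add: entry_def)

section \<open>Correctness and running time of the phases\<close>

lemma achieves_offsets:
  assumes "regs s 0 = n" "regs s 1 = m" "regs s 2 = 0" "regs s 3 = 0" "regs s 5 = 0"
    and "arrays s 1 = (\<lambda>_. 0)" "rows (arrays s 0)"
  shows "achieves offsets (6 + 15 * n) (\<lambda>s'. stores (\<lambda>_. 0) 0 s' \<and> regs s' 3 = 0) s"
proof -
  let ?I = "\<lambda>k (s :: memory). regs s 0 = n \<and> regs s 1 = m \<and> regs s 2 = 0 \<and> regs s 3 = 0 \<and> regs s 5 = k * m \<and>
    arrays s 1 = (\<lambda>_. 0) \<and> rows (arrays s 0) \<and> (\<forall>i<k. arrays s 2 i = i * m)"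
  have body: "achieves (Seq (Store 2 (Reg 4) (Reg 5)) (Assign 5 (Add (Reg 5) (Reg 1)))) 7
      (\<lambda>s'. regs s' 4 = k \<and> ?I (Suc k) (set_reg 4 (Suc k) s')) s"
    if "?I k s" "regs s 4 = k" for k s
  proof (rule achieves_Seq[where T = 3 and T' = 4], rule achieves_Store, rule achieves_Assign)
    let ?s = "set_cell 2 (eval_expr (Reg 4) s) (eval_expr (Reg 5) s) s"
    let ?s' = "set_reg 5 (eval_expr (Add (Reg 5) (Reg 1)) ?s) ?s"
    show "regs ?s' 4 = k \<and> ?I (Suc k) (set_reg 4 (Suc k) ?s')"
      using that by (simp add: less_Suc_eq)
  qed simp_all
  show ?thesis
    unfolding offsets_def
  proof (rule achieves_For[where N = n and T = 7 and I = ?I, OF _ _ body])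
    show "?I 0 (set_reg 4 0 s)" using assms by simp
  next
    fix s :: memory assume "?I n s"
    then show "stores (\<lambda>_. 0) 0 s \<and> regs s 3 = 0" unfolding stores_def by blast
  qed auto
qed

lemma achieves_pick:
  assumes "stores out r s" "regs s 5 = i" "i < n" "regs s 4 = l" "regs s 3 = stop"
  shows "achieves pick (17 + 21 * m) (\<lambda>s'. regs s' 5 = i \<and> regs s' 4 = l \<and>
    ((\<exists>g\<in>\<Gamma> i. out g = 0 \<and> stores (out(g := Suc i)) r s' \<and> regs s' 3 = stop) \<or>
     (\<forall>g\<in>\<Gamma> i. out g \<noteq> 0) \<and> stores out r s' \<and> regs s' 3 = 1)) s"
    (is "achieves _ _ ?Q s")
proof -
  \<comment> \<open>Later hits overwrite earlier ones; the invariant only asks register 7 to code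
    some free approved item.\<close>
  let ?found = "\<lambda>k s. stores out r s \<and> regs s 5 = i \<and> regs s 4 = l \<and> regs s 3 = stop \<and>
    (regs s 7 = 0 \<and> (\<forall>g<k. g \<in> \<Gamma> i \<longrightarrow> out g \<noteq> 0) \<or> (\<exists>g\<in>\<Gamma> i. regs s 7 = Suc g \<and> out g = 0))"
  have search: "achieves (For 6 (Reg 1) (IfNZ (Sub (entry 5 6) (Cell 1 (Reg 6)))
      (Assign 7 (Add (Reg 6) (Const 1))) Skip)) (6 + 21 * m) (?found m) s"
    if "?found 0 s" for s
  proof (rule achieves_For[where N = m and T = 13 and I = ?found])
    fix k s assume "k < m" "?found k s" "regs s 6 = k"
    then show "achieves (IfNZ (Sub (entry 5 6) (Cell 1 (Reg 6))) (Assign 7 (Add (Reg 6) (Const 1))) Skip)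
        13 (\<lambda>s'. regs s' 6 = k \<and> ?found (Suc k) (set_reg 6 (Suc k) s')) s"
      using \<open>i < n\<close>
      by (intro achieves_IfNZ[where T = 4] achieves_Assign achieves_Skip)
         (auto simp: less_Suc_eq split: if_splits split_of_bool_asm)
  qed (use that in auto)
  have give: "achieves (IfNZ (Reg 7) (Store 1 (Sub (Reg 7) (Const 1)) (Add (Reg 5) (Const 1)))
      (Assign 3 (Const 1))) 9 ?Q s" if found: "?found m s" for s
  proof (rule achieves_IfNZ[where T = 7])
    assume "eval_expr (Reg 7) s \<noteq> 0"
    then obtain g where g: "g \<in> \<Gamma> i" "regs s 7 = Suc g" "out g = 0"
      using found by auto
    then show "achieves (Store 1 (Sub (Reg 7) (Const 1)) (Add (Reg 5) (Const 1))) 7 ?Q s"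
      using found stores_set_cell[of out r s g "Suc i"] by (intro achieves_Store) auto
  next
    assume "eval_expr (Reg 7) s = 0"
    then show "achieves (Assign 3 (Const 1)) 7 ?Q s"
      using found \<Gamma>_subset[OF \<open>i < n\<close>] by (intro achieves_Assign) auto
  qed simp
  show ?thesis
    unfolding pick_def
    apply (rule achieves_Seq[where T = 2 and T' = "15 + 21 * m"])
     apply (rule achieves_Assign)
      apply (rule achieves_Seq[where T = "6 + 21 * m" and T' = 9])
       apply (rule achieves_mono[OF search order_refl give])
    using assms by auto
qed

lemma achieves_round:
  assumes "stores out r s" "in_round out r 0 0" "regs s 4 = l" "regs s 3 = 0"
  shows "achieves (For 5 (Reg 0) pick) (6 + n * (25 + 21 * m)) (\<lambda>s'. regs s' 4 = l \<and>
    (\<exists>out'. stores out' r s' \<and> in_round out' r n (regs s' 3))) s"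
\<comment> \<open>The flag is read from register 3, so one invariant covers both outcomes of
  \<open>pick\<close>.\<close>
proof (rule achieves_For[where N = n and T = "17 + 21 * m" and
    I = "\<lambda>i s. regs s 4 = l \<and> (\<exists>out'. stores out' r s \<and> in_round out' r i (regs s 3))"])
  fix i s
  assume "i < n" "regs s 4 = l \<and> (\<exists>out'. stores out' r s \<and> in_round out' r i (regs s 3))"
    and "regs s 5 = i"
  then obtain out' where *: "stores out' r s" "in_round out' r i (regs s 3)" "regs s 4 = l"
    by blast
  show "achieves pick (17 + 21 * m) (\<lambda>s'. regs s' 5 = i \<and>
      regs (set_reg 5 (Suc i) s') 4 = l \<and> (\<exists>out'. stores out' r (set_reg 5 (Suc i) s') \<and>
      in_round out' r (Suc i) (regs (set_reg 5 (Suc i) s') 3))) s"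
    by (rule achieves_mono[OF achieves_pick[OF *(1) \<open>regs s 5 = i\<close> \<open>i < n\<close> *(3) refl] order_refl])
       (use in_round_give[OF *(2) \<open>i < n\<close>] in_round_stop[OF *(2) \<open>i < n\<close>] in \<open>auto; blast\<close>)
qed (use assms in auto)

lemma achieves_rounds:
  assumes "stores (\<lambda>_. 0) 0 s" "regs s 3 = 0"
  shows "achieves rounds (8 + (m + 1) * (22 + n * (25 + 21 * m)))
    (\<lambda>s'. \<exists>out r. stores out r s' \<and> capped out r) s"
proof -
  \<comment> \<open>Either no agent has failed and the loop counter is the number of complete
    rounds, or the final cap has been reached and nothing changes any more.\<close>
  let ?I = "\<lambda>k s. \<exists>out r. stores out r s \<and>
    (regs s 3 = 0 \<and> r = k \<and> in_round out r 0 0 \<or> regs s 3 \<noteq> 0 \<and> capped out r)"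
  let ?P = "IfNZ (Reg 3) Skip (Seq (For 5 (Reg 0) pick) (Assign 2 (Add (Reg 2) (Const 1))))"
  show ?thesis
    unfolding rounds_def
  proof (rule achieves_For[where N = "m + 1" and T = "12 + n * (25 + 21 * m)" and I = ?I])
    show "?I 0 (set_reg 4 0 s)"
      using assms by (intro exI[of _ "\<lambda>_. 0"] exI[of _ 0]) (simp add: in_round_def load_def)
  next
    fix k s assume "k < m + 1" and I: "?I k s" and k: "regs s 4 = k"
    show "achieves ?P (12 + n * (25 + 21 * m))
        (\<lambda>s'. regs s' 4 = k \<and> ?I (Suc k) (set_reg 4 (Suc k) s')) s"
    proof (rule achieves_IfNZ[where T = "10 + n * (25 + 21 * m)"])
      assume "eval_expr (Reg 3) s \<noteq> 0"
      then show "achieves Skip (10 + n * (25 + 21 * m))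
          (\<lambda>s'. regs s' 4 = k \<and> ?I (Suc k) (set_reg 4 (Suc k) s')) s"
        using I k by (intro achieves_Skip) auto
    next
      assume "eval_expr (Reg 3) s = 0"
      then obtain out where out: "stores out k s" "in_round out k 0 0" "regs s 3 = 0"
        using I by auto
      \<comment> \<open>Register 2 becomes \<open>Suc k\<close> in both cases: the number of
        complete rounds after a success, the cap after a failure.\<close>
      have post: "?I (Suc k) (set_reg 4 (Suc k) (set_reg 2 (Suc k) s'))"
        if s': "stores out' k s'" "in_round out' k n (regs s' 3)" for s' out'
      proof (intro exI conjI)
        show "stores out' (Suc k) (set_reg 4 (Suc k) (set_reg 2 (Suc k) s'))"
          using stores_cap[OF s'(1)] by simp
      qed (use s'(2) in_round_next[of out' k] in_round_capped[OF s'(2)] in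
        \<open>cases "regs s' 3 = 0"; simp\<close>)
      show "achieves (Seq (For 5 (Reg 0) pick) (Assign 2 (Add (Reg 2) (Const 1))))
          (10 + n * (25 + 21 * m)) (\<lambda>s'. regs s' 4 = k \<and> ?I (Suc k) (set_reg 4 (Suc k) s')) s"
        apply (rule achieves_Seq[where T = "6 + n * (25 + 21 * m)" and T' = 4])
         apply (rule achieves_mono[OF achieves_round[OF out(1,2) k out(3)] order_refl])
         apply (rule achieves_Assign)
        subgoal for s' using post[of _ s'] by auto
        by auto
    qed simp
  next
    \<comment> \<open>The alternative without failure would mean \<open>m + 1\<close> complete
      rounds, contradicting \<open>in_round_le\<close>.\<close>
    fix s assume "?I (m + 1) s"
    then show "\<exists>out r. stores out r s \<and> capped out r"
      using in_round_le by fastforce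
  qed auto
qed

lemma achieves_find_approver:
  assumes "stores out r s" "regs s 4 = g" "g < m"
  shows "achieves find_approver (8 + 16 * n) (\<lambda>s'. stores out r s' \<and> regs s' 4 = g \<and> regs s' 7 < n \<and>
    (\<forall>i<n. g \<in> \<Gamma> i \<longrightarrow> g \<in> \<Gamma> (regs s' 7))) s"
proof -
  let ?I = "\<lambda>k s. stores out r s \<and> regs s 4 = g \<and> regs s 7 < n \<and>
    (\<forall>i<k. g \<in> \<Gamma> i \<longrightarrow> g \<in> \<Gamma> (regs s 7))"
  have body: "achieves (IfNZ (entry 5 4) (Assign 7 (Reg 5)) Skip) 8
      (\<lambda>s'. regs s' 5 = k \<and> ?I (Suc k) (set_reg 5 (Suc k) s')) s"
    if "k < n" "?I k s" "regs s 5 = k" for k s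
    using that assms(3)
    by (intro achieves_IfNZ[where T = 2] achieves_Assign achieves_Skip)
       (auto simp: less_Suc_eq split: if_splits split_of_bool_asm)
  show ?thesis
    unfolding find_approver_def
    apply (rule achieves_Seq[where T = 2 and T' = "6 + 16 * n"])
     apply (rule achieves_Assign)
      apply (rule achieves_For[where N = n and T = 8 and I = ?I, OF _ _ body])
    using assms n_pos by auto
qed

text \<open>Registers 4, 5, 7 and 8 are tracked because the enclosing loops keep the current item,
  candidate, approver and taker there.\<close>

lemma achieves_count_held:
  assumes "stores out r s" "regs s 5 = j" "regs s 7 = i" "i < n" "regs s 4 = g" "regs s 8 = y"
  shows "achieves count_held (8 + 30 * m) (\<lambda>s'. stores out r s' \<and> regs s' 5 = j \<and> regs s' 7 = i \<and>
    regs s' 4 = g \<and> regs s' 8 = y \<and> regs s' 9 = held out j i) s"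
proof -
  let ?I = "\<lambda>k s. stores out r s \<and> regs s 5 = j \<and> regs s 7 = i \<and> regs s 4 = g \<and> regs s 8 = y \<and>
    regs s 9 = card {h \<in> \<Gamma> i. h < k \<and> out h = Suc j}"
  have step: "card {h \<in> \<Gamma> i. h < Suc k \<and> out h = Suc j} =
      card {h \<in> \<Gamma> i. h < k \<and> out h = Suc j} + of_bool (k \<in> \<Gamma> i \<and> out k = Suc j)" for k
  proof -
    have "{h \<in> \<Gamma> i. h < Suc k \<and> out h = Suc j} =
        (if k \<in> \<Gamma> i \<and> out k = Suc j then insert k {h \<in> \<Gamma> i. h < k \<and> out h = Suc j}
         else {h \<in> \<Gamma> i. h < k \<and> out h = Suc j})"
      by (auto simp: less_Suc_eq)
    then show ?thesis using finite_\<Gamma>[OF \<open>i < n\<close>] by simp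
  qed
  have all: "{h \<in> \<Gamma> i. h < m \<and> out h = Suc j} = {h \<in> \<Gamma> i. out h = Suc j}"
    using \<Gamma>_subset[OF \<open>i < n\<close>] by auto
  have body: "achieves (IfNZ (Add (Sub (Cell 1 (Reg 6)) (Add (Reg 5) (Const 1)))
                (Sub (Add (Reg 5) (Const 1)) (Cell 1 (Reg 6))))
        Skip (Assign 9 (Add (Reg 9) (entry 7 6)))) 22
      (\<lambda>s'. regs s' 6 = k \<and> ?I (Suc k) (set_reg 6 (Suc k) s')) s"
    if "k < m" "?I k s" "regs s 6 = k" for k s
    using that assms(4)
    by (intro achieves_IfNZ[where T = 8] achieves_Assign achieves_Skip) (auto simp: step)
  show ?thesis
    unfolding count_held_def
    apply (rule achieves_Seq[where T = 2 and T' = "6 + 30 * m"])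
     apply (rule achieves_Assign)
      apply (rule achieves_For[where N = m and T = 22 and I = ?I, OF _ _ body])
    using assms by (auto simp: held_def all)
qed

text \<open>The claim on the cap is conditional; \<open>capped_taker\<close> later supplies an agent
  with room, which keeps counting out of the program reasoning.\<close>

lemma achieves_find_taker:
  assumes "stores out r s" "regs s 7 = i" "i < n" "regs s 4 = g"
  shows "achieves find_taker (8 + n * (22 + 30 * m)) (\<lambda>s'. stores out r s' \<and> regs s' 4 = g \<and>
    regs s' 8 < n \<and> (\<forall>j<n. held out j i < r \<longrightarrow> held out (regs s' 8) i < r)) s"
proof -
  let ?I = "\<lambda>k s. stores out r s \<and> regs s 7 = i \<and> regs s 4 = g \<and> regs s 8 < n \<and>
    (\<forall>j<k. held out j i < r \<longrightarrow> held out (regs s 8) i < r)"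
  let ?P = "Seq count_held (IfNZ (Sub (Reg 2) (Reg 9)) (Assign 8 (Reg 5)) Skip)"
  have body: "achieves ?P (14 + 30 * m)
      (\<lambda>s'. regs s' 5 = k \<and> ?I (Suc k) (set_reg 5 (Suc k) s')) s"
    if *: "k < n" "?I k s" "regs s 5 = k" for k s
  proof (rule achieves_Seq[where T = "8 + 30 * m" and T' = 6])
    have "stores out r s" "regs s 7 = i" "regs s 4 = g" using * by auto
    note count = achieves_count_held[OF this(1) *(3) this(2) \<open>i < n\<close> this(3) refl]
    show "achieves count_held (8 + 30 * m) (achieves
        (IfNZ (Sub (Reg 2) (Reg 9)) (Assign 8 (Reg 5)) Skip) 6
        (\<lambda>s'. regs s' 5 = k \<and> ?I (Suc k) (set_reg 5 (Suc k) s'))) s"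
      apply (rule achieves_mono[OF count order_refl])
      using * by (intro achieves_IfNZ[where T = 2] achieves_Assign achieves_Skip)
        (auto simp: less_Suc_eq)
  qed simp
  show ?thesis
    unfolding find_taker_def
    apply (rule achieves_Seq[where T = 2 and T' = "6 + n * (22 + 30 * m)"])
     apply (rule achieves_Assign)
      apply (rule achieves_For[where N = n and T = "14 + 30 * m" and I = ?I, OF _ _ body])
    using assms n_pos by auto
qed

lemma achieves_completion:
  assumes "stores out r s" "capped out r"
  shows "achieves completion (6 + m * (32 + 16 * n + n * (22 + 30 * m)))
    (\<lambda>s'. capped (arrays s' 1) r \<and> (\<forall>g<m. arrays s' 1 g \<noteq> 0)) s"
proof -
  let ?I = "\<lambda>k s. \<exists>out. stores out r s \<and> capped out r \<and> (\<forall>g<k. out g \<noteq> 0)"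
  let ?A = "Seq find_approver (Seq find_taker (Store 1 (Reg 4) (Add (Reg 8) (Const 1))))"
  let ?T = "21 + 16 * n + n * (22 + 30 * m)"
  have body: "achieves (IfNZ (Cell 1 (Reg 4)) Skip ?A) (3 + ?T)
      (\<lambda>s'. regs s' 4 = k \<and> ?I (Suc k) (set_reg 4 (Suc k) s')) s"
    if *: "k < m" "?I k s" "regs s 4 = k" for k s
  proof (rule achieves_IfNZ[where T = "?T"])
    assume "eval_expr (Cell 1 (Reg 4)) s \<noteq> 0"
    then show "achieves Skip ?T (\<lambda>s'. regs s' 4 = k \<and> ?I (Suc k) (set_reg 4 (Suc k) s')) s"
      using * by (intro achieves_Skip) (auto simp: less_Suc_eq)
  next
    assume "eval_expr (Cell 1 (Reg 4)) s = 0"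
    then obtain out where out: "stores out r s" "capped out r" "\<forall>g<k. out g \<noteq> 0" "out k = 0"
      using * by auto
    have post: "?I (Suc k) (set_reg 4 (Suc k) (set_cell 1 k (Suc j) s'))"
      if s': "stores out r s'" and i: "i < n" "\<forall>i'<n. k \<in> \<Gamma> i' \<longrightarrow> k \<in> \<Gamma> i"
        and j: "j < n" "\<forall>j'<n. held out j' i < r \<longrightarrow> held out j i < r" for s' i j
    proof -
      \<comment> \<open>The taker was tested against one approver \<open>i\<close> only. Any other
        approver has the same approval set, so the room found there serves all approvers.\<close>
      have "held out j i' < r" if "i' < n" "k \<in> \<Gamma> i'" for i'
      proof -
        have "k \<in> \<Gamma> i" using i that by blast
        then have "\<Gamma> i' = \<Gamma> i" using \<Gamma>_eq that i by blast
        moreover have "held out j i < r"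
          using capped_taker[OF out(2) i(1) \<open>k \<in> \<Gamma> i\<close> out(4)] j by blast
        ultimately show ?thesis by (simp add: held_def)
      qed
      from capped_give[OF out(2,4) j(1) this] show ?thesis
        using stores_set_cell[OF s', of k "Suc j"] out(3)
        by (intro exI[of _ "out(k := Suc j)"]) (auto simp: less_Suc_eq)
    qed
    show "achieves ?A ?T (\<lambda>s'. regs s' 4 = k \<and> ?I (Suc k) (set_reg 4 (Suc k) s')) s"
    proof (rule achieves_Seq[where T = "8 + 16 * n" and T' = "13 + n * (22 + 30 * m)"],
        rule achieves_mono[OF achieves_find_approver[OF out(1) *(3,1)] order_refl])
      fix s' assume s': "stores out r s' \<and> regs s' 4 = k \<and> regs s' 7 < n \<and>
        (\<forall>i<n. k \<in> \<Gamma> i \<longrightarrow> k \<in> \<Gamma> (regs s' 7))"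
      show "achieves (Seq find_taker (Store 1 (Reg 4) (Add (Reg 8) (Const 1))))
          (13 + n * (22 + 30 * m)) (\<lambda>s'. regs s' 4 = k \<and> ?I (Suc k) (set_reg 4 (Suc k) s')) s'"
        apply (rule achieves_Seq[where T = "8 + n * (22 + 30 * m)" and T' = 5])
         apply (rule achieves_mono[OF achieves_find_taker[where g = k, OF _ refl] order_refl])
        using s' apply (blast, blast, blast)
         apply (rule achieves_Store)
        subgoal for s'' using s' post[of s'' "regs s' 7" "regs s'' 8"] by auto
        by auto
    qed simp
  qed simp
  show ?thesis
    unfolding completion_def
    apply (rule achieves_For[where N = m and T = "3 + ?T" and I = ?I, OF _ _ body])
    using assms by (auto simp: algebra_simps)
qed

lemma achieves_allocate:
  assumes "regs s 0 = n" "regs s 1 = m" "regs s 2 = 0" "regs s 3 = 0" "regs s 5 = 0"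
    and "arrays s 1 = (\<lambda>_. 0)" "rows (arrays s 0)"
  shows "achieves allocate (200 * (n + m + 1) ^ 3)
    (\<lambda>s'. \<exists>r. capped (arrays s' 1) r \<and> (\<forall>g<m. arrays s' 1 g \<noteq> 0)) s"
    (is "achieves _ _ ?Q s")
proof -
  define R where "R = 8 + (m + 1) * (22 + n * (25 + 21 * m))"
  define C where "C = 6 + m * (32 + 16 * n + n * (22 + 30 * m))"
  \<comment> \<open>Once multiplied out, each monomial on the left has coefficient below 200 and
    occurs on the right with coefficient at least 200.\<close>
  have "6 + 15 * n + (R + C) \<le> 200 * (n + m + 1) ^ 3"
    unfolding R_def C_def by (simp add: power3_eq_cube algebra_simps)
  then show ?thesis
    unfolding allocate_def
  proof (rule achieves_Seq[rotated])
    show "achieves offsets (6 + 15 * n) (achieves (Seq rounds completion) (R + C) ?Q) s"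
    proof (rule achieves_mono[OF achieves_offsets[OF assms] order_refl])
      fix s assume s: "stores (\<lambda>_. 0) 0 s \<and> regs s 3 = 0"
      show "achieves (Seq rounds completion) (R + C) ?Q s"
      proof (rule achieves_Seq[OF _ order_refl])
        show "achieves rounds R (achieves completion C ?Q) s"
          unfolding R_def
        proof (rule achieves_mono[OF achieves_rounds order_refl])
          fix s assume "\<exists>out r. stores out r s \<and> capped out r"
          then obtain out r where "stores out r s" "capped out r" by blast
          note completion = achieves_completion[OF this]
          show "achieves completion C ?Q s"
            unfolding C_def by (rule achieves_mono[OF completion order_refl], rule exI)
        qed (use s in auto)
      qed
    qed
  qed
qed

end

section \<open>Fairness of the outcome\<close>

lemma value_eq_card:
  assumes inst: "fair_division_instance n M v" "binary_goods n M v"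
    and i: "i \<in> {1..n}" and S: "S \<subseteq> M"
  shows "v i S = card (approval_set M v i \<inter> S)"
proof -
  have fin: "finite S" using inst S finite_subset by (auto simp: fair_division_instance_def)
  have "v i S = (\<Sum>g\<in>S. v i {g})"
    using inst i S by (simp add: fair_division_instance_def)
  also have "\<dots> = (\<Sum>g\<in>S. of_bool (g \<in> approval_set M v i))"
  proof (rule sum.cong[OF refl])
    fix g assume "g \<in> S"
    then have "g \<in> M" using S by blast
    moreover from this have "v i {g} \<in> {0, 1}"
      using inst(2) i unfolding binary_goods_def by blast
    ultimately show "v i {g} = of_bool (g \<in> approval_set M v i)"
      by (auto simp: approval_set_def)
  qed
  also have "\<dots> = card (approval_set M v i \<inter> S)"
    using fin by (simp add: sum.If_cases of_bool_def Int_commute)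
  finally show ?thesis .
qed

text \<open>Both notions compare with the threshold \<open>r - 1\<close>: each own bundle reaches
  it, and dropping a suitable item brings any bundle down to it. EF1 applies \<open>drop\<close> to
  the valuation of \<open>i\<close>, EQ1 to that of the owner \<open>j\<close>.\<close>

lemma fair_of_counts:
  assumes inst: "fair_division_instance n M v" "binary_goods n M v" and A: "\<And>j. j \<in> {1..n} \<Longrightarrow> A j \<subseteq> M"
    and own: "\<And>j. j \<in> {1..n} \<Longrightarrow> r \<le> Suc (card (approval_set M v j \<inter> A j))"
    and cap: "\<And>i j. i \<in> {1..n} \<Longrightarrow> j \<in> {1..n} \<Longrightarrow> card (approval_set M v i \<inter> A j) \<le> r"
  shows "EF1 n v A" "EQ1 n v A"
proof -
  note val = value_eq_card[OF inst]
  have val_Diff: "v i (A j - {g}) = card (approval_set M v i \<inter> (A j - {g}))"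
    if "i \<in> {1..n}" "j \<in> {1..n}" for i j g
    using val[OF that(1)] A[OF that(2)] by blast
  have drop: "\<exists>g\<in>A j. real (r - 1) \<ge> v i (A j - {g})"
    if "i \<in> {1..n}" "j \<in> {1..n}" "A j \<noteq> {}" for i j
  proof (cases "approval_set M v i \<inter> A j = {}")
    case True
    obtain g where "g \<in> A j" using \<open>A j \<noteq> {}\<close> by blast
    moreover have "approval_set M v i \<inter> (A j - {g}) = {}" using True by blast
    ultimately show ?thesis using val_Diff[OF that(1,2), of g] by (intro bexI[of _ g]) auto
  next
    case False
    then obtain g where g: "g \<in> A j" "g \<in> approval_set M v i" by blast
    have "approval_set M v i \<inter> (A j - {g}) = (approval_set M v i \<inter> A j) - {g}" by blast
    then have "card (approval_set M v i \<inter> (A j - {g})) \<le> r - 1"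
      using g cap[of i j] that by (simp add: card_Diff_singleton)
    then show ?thesis using g val_Diff[OF that(1,2), of g] by (intro bexI[of _ g]) auto
  qed
  have low: "real (r - 1) \<le> v j (A j)" if "j \<in> {1..n}" for j
    using own[OF that] val[OF that A[OF that]] by simp
  show "EF1 n v A" "EQ1 n v A"
    unfolding EF1_def EQ1_def using drop low by (meson order_trans)+
qed

section \<open>Reduction to disjoint approvals and transfer to arbitrary items\<close>

lemma disjoint_approvals_of_laminar:
  assumes "fair_division_instance n {..<m} v" "binary_goods n {..<m} v"
    and "normalized n {..<m} v" "laminar_approvals n {..<m} v"
  shows "disjoint_approvals n m (card (approval_set {..<m} v 1)) (\<lambda>i. approval_set {..<m} v (Suc i))"
proof -
  let ?G = "approval_set {..<m} v"
  have fin: "finite (?G i)" for i by (simp add: approval_set_def)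
  have total: "v i {..<m} = card (?G i)" if "i \<in> {1..n}" for i
  proof -
    have "?G i \<inter> {..<m} = ?G i" by (auto simp: approval_set_def)
    then show ?thesis using value_eq_card[OF assms(1,2) that order_refl] by simp
  qed
  have card_eq: "card (?G i) = card (?G j)" if "i \<in> {1..n}" "j \<in> {1..n}" for i j
    using assms(3) that total unfolding normalized_def by (metis of_nat_eq_iff)
  \<comment> \<open>A common item rules out disjointness, so one set contains the other; being
    finite and of equal size, they coincide.\<close>
  have eq: "?G i = ?G j" if "i \<in> {1..n}" "j \<in> {1..n}" "g \<in> ?G i" "g \<in> ?G j" for i j g
    using assms(4) that card_eq[OF that(1,2)] fin card_subset_eq
    unfolding laminar_approvals_def by (metis disjoint_iff)
  show ?thesis
  proof
    show "n \<ge> 1" using assms(1) by (simp add: fair_division_instance_def)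
    show "?G (Suc i) \<subseteq> {..<m}" for i by (auto simp: approval_set_def)
    show "card (?G (Suc i)) = card (?G 1)" if "i < n" for i
      using that by (intro card_eq) auto
    show "?G (Suc i) = ?G (Suc j)" if "i < n" "j < n" "g \<in> ?G (Suc i)" "g \<in> ?G (Suc j)" for i j g
      using that by (intro eq[of _ _ g]) auto
  qed
qed

lemma allocate_correct:
  assumes inst: "fair_division_instance n {..<m} v" "binary_goods n {..<m} v"
    "normalized n {..<m} v" "laminar_approvals n {..<m} v"
  shows "\<exists>t s. runs allocate (input_memory n m v) t s \<and> t \<le> 200 * (n + m + 1) ^ 3 \<and>
    allocation n {..<m} (output_bundles m s) \<and> EF1 n v (output_bundles m s) \<and>
    EQ1 n v (output_bundles m s)"
proof -
  let ?G = "approval_set {..<m} v"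
  interpret disjoint_approvals n m "card (?G 1)" "\<lambda>i. ?G (Suc i)"
    using disjoint_approvals_of_laminar[OF inst] .
  have rows: "rows (arrays (input_memory n m v) 0)"
    unfolding rows_def
  proof (intro allI impI)
    fix i g assume "i < n" "g < m"
    \<comment> \<open>The cell lies inside the matrix, and \<open>div\<close> and \<open>mod\<close>
      by \<open>m\<close> recover \<open>i\<close> and \<open>g\<close>.\<close>
    then have "i * m + g < Suc i * m" "Suc i * m \<le> n * m"
      by (simp, intro mult_le_mono1, simp)
    then have "i * m + g < n * m" by linarith
    then show "arrays (input_memory n m v) 0 (i * m + g) = of_bool (g \<in> ?G (Suc i))"
      using \<open>g < m\<close> by (simp add: input_memory_def approval_set_def)
  qed
  obtain t s r where t: "runs allocate (input_memory n m v) t s" "t \<le> 200 * (n + m + 1) ^ 3"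
    and s: "capped (arrays s 1) r" "\<forall>g<m. arrays s 1 g \<noteq> 0"
    using achieves_allocate[OF _ _ _ _ _ _ rows]
    unfolding achieves_def by (auto simp: input_memory_def)
  have approved: "?G i \<inter> output_bundles m s j = {g \<in> ?G i. arrays s 1 g = j}" for i j
    by (auto simp: output_bundles_def approval_set_def)
  \<comment> \<open>The subtractions of 1 translate agents \<open>{1..n}\<close> to the numbering
    from 0.\<close>
  have held: "card (?G i \<inter> output_bundles m s j) = held (arrays s 1) (j - 1) (i - 1)"
    if "i \<in> {1..n}" "j \<in> {1..n}" for i j
    using that by (simp add: held_def approved)
  have pred: "i - 1 < n" if "i \<in> {1..n}" for i using that by auto
  have sub: "output_bundles m s j \<subseteq> {..<m}" for j by (auto simp: output_bundles_def)
  have own: "r \<le> Suc (card (?G j \<inter> output_bundles m s j))" if "j \<in> {1..n}" for j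
    using s(1) pred[OF that] unfolding held[OF that that] capped_def by blast
  have cap: "card (?G i \<inter> output_bundles m s j) \<le> r" if "i \<in> {1..n}" "j \<in> {1..n}" for i j
    using s(1) pred[OF that(1)] pred[OF that(2)] unfolding held[OF that] capped_def by blast
  have "EF1 n v (output_bundles m s)" "EQ1 n v (output_bundles m s)"
    using fair_of_counts[OF inst(1,2) sub own cap] by blast+
  moreover have "allocation n {..<m} (output_bundles m s)"
    using s unfolding allocation_def disjoint_family_on_def output_bundles_def capped_def
    by (auto simp: Suc_le_eq)
  ultimately show ?thesis using t by blast
qed

text \<open>Valuations are pulled back along a bijection \<open>f\<close> from \<open>{..<m}\<close>
  to \<open>M\<close>, and the bundles computed there are pushed forward by images.\<close>

lemma fair_allocation_exists:
  fixes M :: "'a set"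
  assumes inst: "fair_division_instance n M v" "binary_goods n M v" "normalized n M v"
    "laminar_approvals n M v"
  shows "\<exists>A. allocation n M A \<and> EF1 n v A \<and> EQ1 n v A"
proof -
  define m where "m = card M"
  obtain f where f: "bij_betw f {..<m} M"
    using inst ex_bij_betw_nat_finite[of M]
    by (auto simp: fair_division_instance_def m_def atLeast0LessThan)
  have im: "f ` {..<m} = M" and inj: "inj_on f {..<m}" using f by (auto simp: bij_betw_def)
  let ?v = "\<lambda>i S. v i (f ` S)"
  have approval: "approval_set {..<m} ?v i = {g \<in> {..<m}. f g \<in> approval_set M v i}" for i
    using im by (auto simp: approval_set_def)
  have "fair_division_instance n {..<m} ?v"
    unfolding fair_division_instance_def
  proof (intro conjI ballI allI impI)
    fix i S assume "i \<in> {1..n}" "S \<subseteq> {..<m}"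
    moreover from this have "f ` S \<subseteq> M" using im by blast
    ultimately have "v i (f ` S) = (\<Sum>g\<in>f ` S. v i {g})"
      using inst(1) unfolding fair_division_instance_def by blast
    also have "\<dots> = (\<Sum>g\<in>S. v i {f g})"
      using inj \<open>S \<subseteq> {..<m}\<close> by (simp add: sum.reindex inj_on_subset)
    finally show "v i (f ` S) = (\<Sum>g\<in>S. v i (f ` {g}))" by simp
  qed (use inst(1) in \<open>auto simp: fair_division_instance_def\<close>)
  moreover have "binary_goods n {..<m} ?v"
    using inst(2) im unfolding binary_goods_def by fastforce
  moreover have "normalized n {..<m} ?v"
    using inst(3) unfolding normalized_def im .
  moreover have "laminar_approvals n {..<m} ?v"
    unfolding laminar_approvals_def approval
  proof (intro ballI)
    fix i j assume "i \<in> {1..n}" "j \<in> {1..n}"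
    then consider "approval_set M v i \<inter> approval_set M v j = {}"
      | "approval_set M v i \<subseteq> approval_set M v j" | "approval_set M v j \<subseteq> approval_set M v i"
      using inst(4) unfolding laminar_approvals_def by blast
    then show "{g \<in> {..<m}. f g \<in> approval_set M v i} \<inter> {g \<in> {..<m}. f g \<in> approval_set M v j} = {} \<or>
      {g \<in> {..<m}. f g \<in> approval_set M v i} \<subseteq> {g \<in> {..<m}. f g \<in> approval_set M v j} \<or>
      {g \<in> {..<m}. f g \<in> approval_set M v j} \<subseteq> {g \<in> {..<m}. f g \<in> approval_set M v i}"
      by cases auto
  qed
  ultimately obtain A where A: "allocation n {..<m} A" "EF1 n ?v A" "EQ1 n ?v A"
    using allocate_correct[of n m ?v] by auto
  have sub: "A j \<subseteq> {..<m}" if "j \<in> {1..n}" for j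
    using A(1) that by (auto simp: allocation_def)
  have diff: "f ` (A j - {g}) = f ` A j - {f g}" if "j \<in> {1..n}" "g \<in> A j" for j g
    using inj_on_image_set_diff[OF inj, of "A j" "{g}"] sub[OF that(1)] that(2) by auto
  \<comment> \<open>The free \<open>l\<close> and \<open>c\<close> let this serve both EF1 and
    EQ1.\<close>
  have drop: "\<exists>h\<in>f ` A j. v l (f ` A j - {h}) \<le> c"
    if j: "j \<in> {1..n}" and ex: "\<exists>g\<in>A j. v l (f ` (A j - {g})) \<le> c" for j l c
  proof -
    obtain g where "g \<in> A j" "v l (f ` (A j - {g})) \<le> c" using ex by blast
    then show ?thesis using diff[OF j] by (intro bexI[of _ "f g"]) auto
  qed
  have "allocation n M (\<lambda>i. f ` A i)"
    unfolding allocation_def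
  proof
    show "disjoint_family_on (\<lambda>i. f ` A i) {1..n}"
      using A(1) sub inj_on_image_Int[OF inj] unfolding allocation_def disjoint_family_on_def
      by (metis image_empty)
    show "(\<Union>i\<in>{1..n}. f ` A i) = M"
      using A(1) im unfolding allocation_def by (metis image_UN)
  qed
  moreover have "EF1 n v (\<lambda>i. f ` A i)"
    unfolding EF1_def
  proof (intro ballI impI)
    fix i j assume "i \<in> {1..n}" "j \<in> {1..n}" "f ` A j \<noteq> {}"
    then show "\<exists>g\<in>f ` A j. v i (f ` A j - {g}) \<le> v i (f ` A i)"
      using A(2) unfolding EF1_def by (intro drop) auto
  qed
  moreover have "EQ1 n v (\<lambda>i. f ` A i)"
    unfolding EQ1_def
  proof (intro ballI impI)
    fix i j assume "i \<in> {1..n}" "j \<in> {1..n}" "f ` A j \<noteq> {}"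
    then show "\<exists>g\<in>f ` A j. v j (f ` A j - {g}) \<le> v i (f ` A i)"
      using A(3) unfolding EQ1_def by (intro drop) auto
  qed
  ultimately show ?thesis by blast
qed

theorem theorem5:
  shows "(\<forall>n (M :: 'a set) v.
            fair_division_instance n M v \<and> binary_goods n M v \<and> normalized n M v \<and>
            laminar_approvals n M v \<longrightarrow>
            (\<exists>A. allocation n M A \<and> EF1 n v A \<and> EQ1 n v A))
       \<and> (\<exists>(P :: prog) (p :: nat poly). \<forall>n m v.
            fair_division_instance n {..<m} v \<and> binary_goods n {..<m} v \<and>
            normalized n {..<m} v \<and> laminar_approvals n {..<m} v \<longrightarrow>
            (\<exists>t s. runs P (input_memory n m v) t s \<and> t \<le> poly p (n + m) \<and>
                   allocation n {..<m} (output_bundles m s) \<and>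
                   EF1 n v (output_bundles m s) \<and> EQ1 n v (output_bundles m s)))"
proof (intro conjI)
  show "\<exists>(P :: prog) (p :: nat poly). \<forall>n m v.
      fair_division_instance n {..<m} v \<and> binary_goods n {..<m} v \<and>
      normalized n {..<m} v \<and> laminar_approvals n {..<m} v \<longrightarrow>
      (\<exists>t s. runs P (input_memory n m v) t s \<and> t \<le> poly p (n + m) \<and>
             allocation n {..<m} (output_bundles m s) \<and>
             EF1 n v (output_bundles m s) \<and> EQ1 n v (output_bundles m s))"
    \<comment> \<open>The polynomial is \<open>200 * (1 + x) ^ 3\<close>, evaluated at
      \<open>x = n + m\<close>.\<close>
    using allocate_correct
    by (intro exI[of _ allocate] exI[of _ "smult 200 ([:1, 1:] ^ 3)"])
       (simp add: add.commute)
qed (use fair_allocation_exists in blast)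

end
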